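(* The dual $X^*$ of the Schreier space $X$ does not have the uniform $\lambda$-property; that is, there is no $\lambda_0>0$ such that $\lambda(x^* )\geqslant\lambda_0$ for all $x^*\in Ba(X^* )$.
   Context: Schreier space: let $c_{00}$ be the vector space of finitely supported real sequences $x=(x(1),x(2),\ldots)$. A set $F\subset\mathbb{N}=\{1,2,\ldots\}$ is admissible if $\min F\geqslant |F|$, and $\mathcal{S}_1$ denotes the collection of all admissible subsets of $\mathbb{N}$. The Schreier space $X$ is the completion of $c_{00}$ with respect to the norm $\|x\|=\sup_{F\in\mathcal{S}_1}\sum_{i\in F}|x(i)|$. $X^*$ is its Banach space dual with the dual norm. For a Banach space $Y$, $Ba(Y)$, $S(Y)$ and $E(Y)$ denote the closed unit ball, the unit sphere and the set of extreme points of the unit ball of $Y$. For $y\in Ba(Y)$, write $(e,z,\lambda)\sim y$ if $e\in E(Y)$, $z\in Ba(Y)$, $0<\lambda\leqslant 1$ and $y=\lambda e+(1-\lambda)z$. $Y$ has the $\lambda$-property if every $y\in Ba(Y)$ admits such a triple. The $\lambda$-function is $\lambda(y)=\sup\{\lambda:(e,z,\lambda)\sim y\}$. $Y$ has the uniform $\lambda$-property if there exists $\lambda_0>0$ such that $\lambda(y)\geqslant\lambda_0$ for all $y\in Ba(Y)$. *)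

theory Defs
  imports "HOL-Analysis.Analysis"
begin

section \<open>The Schreier space\<close>

text \<open>
  Sequences indexed by the positive integers are rendered as functions on \<^typ>\<open>nat\<close> that vanish at
  \<open>0\<close>, so that the indices (and hence the admissibility condition) are those of the literature.
  The guard in the next definition is needed only because \<^term>\<open>Min {}\<close> is unspecified.
\<close>

definition admissible :: "nat set \<Rightarrow> bool" where
  "admissible F \<longleftrightarrow> finite F \<and> 0 \<notin> F \<and> (F \<noteq> {} \<longrightarrow> card F \<le> Min F)"

definition c00 :: "(nat \<Rightarrow> real) set" where
  "c00 = {x. x 0 = 0 \<and> finite {i. x i \<noteq> 0}}"

definition schreier_norm :: "(nat \<Rightarrow> real) \<Rightarrow> real" where
  "schreier_norm x = (SUP F\<in>Collect admissible. \<Sum>i\<in>F. \<bar>x i\<bar>)"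

text \<open>
  The completion of \<^const>\<open>c00\<close> is realised as a space of sequences, namely the sequences that can
  be approximated by elements of \<^const>\<open>c00\<close>. Approximation is expressed by bounding all the
  admissible sums, since a real supremum is meaningless for unbounded sets. That this
  is a completion is shown below: the type is a Banach space (the \<open>banach\<close> instance), its norm is
  the Schreier norm (\<open>norm_schreier_eq\<close>), its operations are coordinatewise, and it contains \<^const>\<open>c00\<close> as a dense subspace
  (\<open>Rep_schreier_c00\<close>, \<open>c00_dense\<close>).
\<close>

typedef schreier =
  "{x :: nat \<Rightarrow> real. x 0 = 0 \<and>
     (\<forall>e>0. \<exists>y\<in>c00. \<forall>F. admissible F \<longrightarrow> (\<Sum>i\<in>F. \<bar>x i - y i\<bar>) \<le> e)}"
  by (rule exI[of _ "\<lambda>_. 0"]) (auto simp: c00_def intro!: exI[of _ "\<lambda>_. 0"])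

lemma admissible_empty [simp]: "admissible {}"
  by (simp add: admissible_def)

lemma admissible_single [simp]: "i > 0 \<Longrightarrow> admissible {i}"
  by (simp add: admissible_def)

lemma Rep_schreier_0 [simp]: "Rep_schreier x 0 = 0"
  using Rep_schreier[of x] by simp

lemma Rep_schreier_approx:
  assumes "e > 0"
  obtains y where "y \<in> c00" "\<And>F. admissible F \<Longrightarrow> (\<Sum>i\<in>F. \<bar>Rep_schreier x i - y i\<bar>) \<le> e"
  using Rep_schreier[of x] assms by auto

lemma schreier_seqI:
  assumes "x 0 = 0"
    and "\<And>e. e > 0 \<Longrightarrow> \<exists>y\<in>c00. \<forall>F. admissible F \<longrightarrow> (\<Sum>i\<in>F. \<bar>x i - y i\<bar>) \<le> e"
  shows "Rep_schreier (Abs_schreier x) = x"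
  using assms by (intro Abs_schreier_inverse) auto

lemma c00_add: "x \<in> c00 \<Longrightarrow> y \<in> c00 \<Longrightarrow> (\<lambda>i. x i + y i) \<in> c00"
  unfolding c00_def
  by (auto intro: finite_subset[where B = "{i. x i \<noteq> 0} \<union> {i. y i \<noteq> 0}"])

lemma c00_scale: "x \<in> c00 \<Longrightarrow> (\<lambda>i. c * x i) \<in> c00"
  unfolding c00_def
  by (auto intro: finite_subset[where B = "{i. x i \<noteq> 0}"])

lemma Rep_schreier_c00: "x \<in> c00 \<Longrightarrow> Rep_schreier (Abs_schreier x) = x"
  by (rule schreier_seqI) (auto simp: c00_def intro!: bexI[of _ x])

lemma schreier_bdd:
  "bdd_above ((\<lambda>F. \<Sum>i\<in>F. \<bar>Rep_schreier x i\<bar>) ` Collect admissible)"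
proof -
  obtain y where y: "y \<in> c00"
    "\<And>F. admissible F \<Longrightarrow> (\<Sum>i\<in>F. \<bar>Rep_schreier x i - y i\<bar>) \<le> 1"
    using Rep_schreier_approx[of 1] by auto
  have fin: "finite {i. y i \<noteq> 0}"
    using y by (simp add: c00_def)
  have "(\<Sum>i\<in>F. \<bar>Rep_schreier x i\<bar>) \<le> 1 + (\<Sum>i | y i \<noteq> 0. \<bar>y i\<bar>)" if F: "admissible F" for F
  proof -
    have finF: "finite F" using F by (simp add: admissible_def)
    have "(\<Sum>i\<in>F. \<bar>Rep_schreier x i\<bar>) \<le> (\<Sum>i\<in>F. \<bar>Rep_schreier x i - y i\<bar> + \<bar>y i\<bar>)"
      by (rule sum_mono) linarith
    also have "\<dots> = (\<Sum>i\<in>F. \<bar>Rep_schreier x i - y i\<bar>) + (\<Sum>i\<in>F. \<bar>y i\<bar>)"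
      by (simp add: sum.distrib)
    also have "(\<Sum>i\<in>F. \<bar>y i\<bar>) = (\<Sum>i\<in>F \<inter> {i. y i \<noteq> 0}. \<bar>y i\<bar>)"
      using finF by (intro sum.mono_neutral_right) auto
    also have "\<dots> \<le> (\<Sum>i | y i \<noteq> 0. \<bar>y i\<bar>)"
      using fin by (intro sum_mono2) auto
    finally show ?thesis using y(2)[OF F] by linarith
  qed
  then show ?thesis by (auto intro!: bdd_aboveI2)
qed

instantiation schreier :: real_vector
begin

definition zero_schreier :: schreier where
  "0 = Abs_schreier (\<lambda>_. 0)"

definition plus_schreier :: "schreier \<Rightarrow> schreier \<Rightarrow> schreier" where
  "x + y = Abs_schreier (\<lambda>i. Rep_schreier x i + Rep_schreier y i)"

definition scaleR_schreier :: "real \<Rightarrow> schreier \<Rightarrow> schreier" where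
  "c *\<^sub>R x = Abs_schreier (\<lambda>i. c * Rep_schreier x i)"

definition uminus_schreier :: "schreier \<Rightarrow> schreier" where
  "- x = (-1) *\<^sub>R (x :: schreier)"

definition minus_schreier :: "schreier \<Rightarrow> schreier \<Rightarrow> schreier" where
  "x - y = x + - (y :: schreier)"

lemma Rep_schreier_zero: "Rep_schreier 0 i = 0"
  unfolding zero_schreier_def by (subst Rep_schreier_c00) (auto simp: c00_def)

lemma Rep_schreier_add: "Rep_schreier (x + y) i = Rep_schreier x i + Rep_schreier y i"
proof -
  have "\<exists>z\<in>c00. \<forall>F. admissible F \<longrightarrow>
          (\<Sum>i\<in>F. \<bar>(Rep_schreier x i + Rep_schreier y i) - z i\<bar>) \<le> e" if "e > 0" for e
  proof -
    obtain u where u: "u \<in> c00"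
      "\<And>F. admissible F \<Longrightarrow> (\<Sum>i\<in>F. \<bar>Rep_schreier x i - u i\<bar>) \<le> e/2"
      using Rep_schreier_approx[OF half_gt_zero[OF \<open>e > 0\<close>], of x] by blast
    obtain v where v: "v \<in> c00"
      "\<And>F. admissible F \<Longrightarrow> (\<Sum>i\<in>F. \<bar>Rep_schreier y i - v i\<bar>) \<le> e/2"
      using Rep_schreier_approx[OF half_gt_zero[OF \<open>e > 0\<close>], of y] by blast
    have "(\<Sum>i\<in>F. \<bar>(Rep_schreier x i + Rep_schreier y i) - (u i + v i)\<bar>) \<le> e"
      if F: "admissible F" for F
    proof -
      have "(\<Sum>i\<in>F. \<bar>(Rep_schreier x i + Rep_schreier y i) - (u i + v i)\<bar>)
          \<le> (\<Sum>i\<in>F. \<bar>Rep_schreier x i - u i\<bar> + \<bar>Rep_schreier y i - v i\<bar>)"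
        by (rule sum_mono) linarith
      also have "\<dots> \<le> e"
        using u(2)[OF F] v(2)[OF F] by (simp add: sum.distrib)
      finally show ?thesis .
    qed
    then show ?thesis using c00_add[OF u(1) v(1)] by (intro bexI[of _ "\<lambda>i. u i + v i"]) auto
  qed
  then show ?thesis unfolding plus_schreier_def by (subst schreier_seqI) auto
qed

lemma Rep_schreier_scaleR: "Rep_schreier (c *\<^sub>R x) i = c * Rep_schreier x i"
proof -
  have "\<exists>z\<in>c00. \<forall>F. admissible F \<longrightarrow> (\<Sum>i\<in>F. \<bar>c * Rep_schreier x i - z i\<bar>) \<le> e"
    if "e > 0" for e
  proof -
    have pos: "e / (\<bar>c\<bar> + 1) > 0" using that by simp
    obtain u where u: "u \<in> c00"
      "\<And>F. admissible F \<Longrightarrow> (\<Sum>i\<in>F. \<bar>Rep_schreier x i - u i\<bar>) \<le> e / (\<bar>c\<bar> + 1)"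
      using Rep_schreier_approx[OF pos, of x] by blast
    have "(\<Sum>i\<in>F. \<bar>c * Rep_schreier x i - c * u i\<bar>) \<le> e" if F: "admissible F" for F
    proof -
      have "(\<Sum>i\<in>F. \<bar>c * Rep_schreier x i - c * u i\<bar>) = \<bar>c\<bar> * (\<Sum>i\<in>F. \<bar>Rep_schreier x i - u i\<bar>)"
        by (simp add: sum_distrib_left abs_mult flip: right_diff_distrib)
      also have "\<dots> \<le> (\<bar>c\<bar> + 1) * (e / (\<bar>c\<bar> + 1))"
        by (intro mult_mono u(2) F) (auto intro: sum_nonneg)
      finally show ?thesis by simp
    qed
    then show ?thesis using c00_scale[OF u(1), of c] by (intro bexI[of _ "\<lambda>i. c * u i"]) auto
  qed
  then show ?thesis unfolding scaleR_schreier_def by (subst schreier_seqI) auto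
qed

lemma Rep_schreier_uminus: "Rep_schreier (- x) i = - Rep_schreier x i"
  by (simp add: uminus_schreier_def Rep_schreier_scaleR)

lemma Rep_schreier_diff: "Rep_schreier (x - y) i = Rep_schreier x i - Rep_schreier y i"
  by (simp add: minus_schreier_def Rep_schreier_add Rep_schreier_uminus)

lemmas Rep_schreier_simps =
  Rep_schreier_zero Rep_schreier_add Rep_schreier_scaleR Rep_schreier_uminus Rep_schreier_diff

instance
  by standard
    (simp_all add: Rep_schreier_inject[symmetric] fun_eq_iff Rep_schreier_simps algebra_simps)

end

instantiation schreier :: real_normed_vector
begin

definition norm_schreier :: "schreier \<Rightarrow> real" where
  norm_schreier_eq: "norm x = schreier_norm (Rep_schreier x)"

definition dist_schreier :: "schreier \<Rightarrow> schreier \<Rightarrow> real" where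
  "dist x y = norm (x - y :: schreier)"

definition sgn_schreier :: "schreier \<Rightarrow> schreier" where
  "sgn x = x /\<^sub>R norm (x :: schreier)"

definition uniformity_schreier :: "(schreier \<times> schreier) filter" where
  "uniformity_schreier = (INF e\<in>{0<..}. principal {(x, y). dist x y < e})"

definition open_schreier :: "schreier set \<Rightarrow> bool" where
  "open_schreier S \<longleftrightarrow> (\<forall>x\<in>S. \<forall>\<^sub>F (x', y) in uniformity. x' = x \<longrightarrow> y \<in> S)"

lemma sum_le_norm_schreier:
  "admissible F \<Longrightarrow> (\<Sum>i\<in>F. \<bar>Rep_schreier x i\<bar>) \<le> norm x"
  unfolding norm_schreier_eq schreier_norm_def
  by (rule cSUP_upper[OF _ schreier_bdd]) simp

lemma norm_schreier_leI:
  "(\<And>F. admissible F \<Longrightarrow> (\<Sum>i\<in>F. \<bar>Rep_schreier x i\<bar>) \<le> c) \<Longrightarrow> norm x \<le> c"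
  unfolding norm_schreier_eq schreier_norm_def
  by (rule cSUP_least) (auto intro: admissible_empty)

lemma coord_le_norm_schreier: "\<bar>Rep_schreier x i\<bar> \<le> norm x"
proof (cases "i = 0")
  case True
  then show ?thesis using sum_le_norm_schreier[of "{}" x] by simp
next
  case False
  then show ?thesis using sum_le_norm_schreier[of "{i}" x] by simp
qed

instance
proof
  fix x y :: schreier and c :: real
  show "(norm x = 0) = (x = 0)"
  proof
    assume "norm x = 0"
    then have "Rep_schreier x i = 0" for i
      using coord_le_norm_schreier[of x i] by simp
    then show "x = 0"
      by (simp add: Rep_schreier_inject[symmetric] fun_eq_iff Rep_schreier_simps)
  next
    assume "x = 0"
    then have "norm x \<le> 0"
      by (intro norm_schreier_leI) (simp add: Rep_schreier_simps)
    then show "norm x = 0"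
      using coord_le_norm_schreier[of x 0] by simp
  qed
  show "norm (x + y) \<le> norm x + norm y"
  proof (rule norm_schreier_leI)
    fix F assume F: "admissible F"
    have "(\<Sum>i\<in>F. \<bar>Rep_schreier (x + y) i\<bar>) \<le> (\<Sum>i\<in>F. \<bar>Rep_schreier x i\<bar> + \<bar>Rep_schreier y i\<bar>)"
      by (rule sum_mono) (simp add: Rep_schreier_simps)
    also have "\<dots> \<le> norm x + norm y"
      using sum_le_norm_schreier[OF F, of x] sum_le_norm_schreier[OF F, of y]
      by (simp add: sum.distrib)
    finally show "(\<Sum>i\<in>F. \<bar>Rep_schreier (x + y) i\<bar>) \<le> norm x + norm y" .
  qed
  have scale_le: "norm (d *\<^sub>R z) \<le> \<bar>d\<bar> * norm z" for d and z :: schreier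
  proof (rule norm_schreier_leI)
    fix F assume F: "admissible F"
    have "(\<Sum>i\<in>F. \<bar>Rep_schreier (d *\<^sub>R z) i\<bar>) = \<bar>d\<bar> * (\<Sum>i\<in>F. \<bar>Rep_schreier z i\<bar>)"
      by (simp add: Rep_schreier_simps abs_mult sum_distrib_left)
    also have "\<dots> \<le> \<bar>d\<bar> * norm z"
      by (intro mult_left_mono sum_le_norm_schreier F) simp
    finally show "(\<Sum>i\<in>F. \<bar>Rep_schreier (d *\<^sub>R z) i\<bar>) \<le> \<bar>d\<bar> * norm z" .
  qed
  show "norm (c *\<^sub>R x) = \<bar>c\<bar> * norm x"
  proof (cases "c = 0")
    case True
    then show ?thesis
      using scale_le[of 0 x] coord_le_norm_schreier[of "0 *\<^sub>R x" 0] by simp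
  next
    case False
    have "norm x \<le> \<bar>inverse c\<bar> * norm (c *\<^sub>R x)"
      using scale_le[of "inverse c" "c *\<^sub>R x"] False by simp
    then have "\<bar>c\<bar> * norm x \<le> norm (c *\<^sub>R x)"
      using False by (simp add: field_simps)
    then show ?thesis using scale_le[of c x] by simp
  qed
qed (simp_all add: dist_schreier_def sgn_schreier_def uniformity_schreier_def open_schreier_def)

end

instance schreier :: banach
proof
  fix X :: "nat \<Rightarrow> schreier"
  assume C: "Cauchy X"
  have cauchy_coord: "Cauchy (\<lambda>n. Rep_schreier (X n) i)" for i
  proof (rule metric_CauchyI)
    fix e :: real assume "e > 0"
    then obtain N where N: "\<And>m n. m \<ge> N \<Longrightarrow> n \<ge> N \<Longrightarrow> norm (X m - X n) < e"
      using CauchyD[OF C] by blast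
    have "dist (Rep_schreier (X m) i) (Rep_schreier (X n) i) < e" if "m \<ge> N" "n \<ge> N" for m n
      using N[OF that] coord_le_norm_schreier[of "X m - X n" i]
      by (simp add: dist_real_def Rep_schreier_simps)
    then show "\<exists>M. \<forall>m\<ge>M. \<forall>n\<ge>M. dist (Rep_schreier (X m) i) (Rep_schreier (X n) i) < e"
      by blast
  qed
  define x where "x i = lim (\<lambda>n. Rep_schreier (X n) i)" for i
  have lim: "(\<lambda>n. Rep_schreier (X n) i) \<longlonglongrightarrow> x i" for i
    using cauchy_coord[of i] unfolding x_def by (simp add: Cauchy_convergent_iff convergent_LIMSEQ_iff)
  have unif: "\<exists>N. \<forall>n\<ge>N. \<forall>F. admissible F \<longrightarrow> (\<Sum>i\<in>F. \<bar>x i - Rep_schreier (X n) i\<bar>) \<le> e"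
    if "e > 0" for e
  proof -
    obtain N where N: "\<And>m n. m \<ge> N \<Longrightarrow> n \<ge> N \<Longrightarrow> norm (X m - X n) < e"
      using CauchyD[OF C \<open>e > 0\<close>] by blast
    have "(\<Sum>i\<in>F. \<bar>x i - Rep_schreier (X n) i\<bar>) \<le> e" if "n \<ge> N" "admissible F" for n F
    proof (rule LIMSEQ_le_const2)
      show "(\<lambda>m. \<Sum>i\<in>F. \<bar>Rep_schreier (X m) i - Rep_schreier (X n) i\<bar>)
              \<longlonglongrightarrow> (\<Sum>i\<in>F. \<bar>x i - Rep_schreier (X n) i\<bar>)"
        by (intro tendsto_intros lim)
      have "(\<Sum>i\<in>F. \<bar>Rep_schreier (X m) i - Rep_schreier (X n) i\<bar>) \<le> e" if "m \<ge> N" for m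
        using N[OF that \<open>n \<ge> N\<close>] sum_le_norm_schreier[OF \<open>admissible F\<close>, of "X m - X n"]
        by (simp add: Rep_schreier_simps)
      then show "\<exists>M. \<forall>m\<ge>M. (\<Sum>i\<in>F. \<bar>Rep_schreier (X m) i - Rep_schreier (X n) i\<bar>) \<le> e"
        by blast
    qed
    then show ?thesis by blast
  qed
  have "x 0 = 0"
    using lim[of 0] by (simp add: LIMSEQ_const_iff)
  moreover have "\<exists>y\<in>c00. \<forall>F. admissible F \<longrightarrow> (\<Sum>i\<in>F. \<bar>x i - y i\<bar>) \<le> e" if "e > 0" for e
  proof -
    obtain n where n: "\<And>F. admissible F \<Longrightarrow> (\<Sum>i\<in>F. \<bar>x i - Rep_schreier (X n) i\<bar>) \<le> e/2"
      using unif[of "e/2"] \<open>e > 0\<close> by auto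
    obtain y where y: "y \<in> c00"
      "\<And>F. admissible F \<Longrightarrow> (\<Sum>i\<in>F. \<bar>Rep_schreier (X n) i - y i\<bar>) \<le> e/2"
      using Rep_schreier_approx[OF half_gt_zero[OF \<open>e > 0\<close>], of "X n"] by blast
    have "(\<Sum>i\<in>F. \<bar>x i - y i\<bar>) \<le> e" if F: "admissible F" for F
    proof -
      have "(\<Sum>i\<in>F. \<bar>x i - y i\<bar>)
          \<le> (\<Sum>i\<in>F. \<bar>x i - Rep_schreier (X n) i\<bar> + \<bar>Rep_schreier (X n) i - y i\<bar>)"
        by (rule sum_mono) linarith
      also have "\<dots> \<le> e" using n[OF F] y(2)[OF F] by (simp add: sum.distrib)
      finally show ?thesis .
    qed
    then show ?thesis using y(1) by blast
  qed
  ultimately have Rep: "Rep_schreier (Abs_schreier x) = x"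
    by (rule schreier_seqI)
  have "X \<longlonglongrightarrow> Abs_schreier x"
  proof (rule LIMSEQ_I)
    fix e :: real assume "e > 0"
    then obtain N where N: "\<And>n F. n \<ge> N \<Longrightarrow> admissible F \<Longrightarrow>
        (\<Sum>i\<in>F. \<bar>x i - Rep_schreier (X n) i\<bar>) \<le> e/2"
      using unif[of "e/2"] by auto
    have "norm (X n - Abs_schreier x) < e" if "n \<ge> N" for n
    proof -
      have "norm (X n - Abs_schreier x) \<le> e/2"
        by (rule norm_schreier_leI)
          (use N[OF that] in \<open>simp add: Rep_schreier_simps Rep abs_minus_commute\<close>)
      then show ?thesis using \<open>e > 0\<close> by linarith
    qed
    then show "\<exists>N. \<forall>n\<ge>N. norm (X n - Abs_schreier x) < e" by blast
  qed
  then show "convergent X" by (rule convergentI)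
qed

lemma c00_dense: "closure (Abs_schreier ` c00) = UNIV"
proof -
  have "\<exists>y\<in>Abs_schreier ` c00. dist y x < e" if "e > 0" for x e
  proof -
    obtain y where y: "y \<in> c00"
      "\<And>F. admissible F \<Longrightarrow> (\<Sum>i\<in>F. \<bar>Rep_schreier x i - y i\<bar>) \<le> e/2"
      using Rep_schreier_approx[OF half_gt_zero[OF \<open>e > 0\<close>], of x] by blast
    have "norm (Abs_schreier y - x) \<le> e/2"
      by (rule norm_schreier_leI)
        (use y in \<open>simp add: Rep_schreier_simps Rep_schreier_c00 abs_minus_commute\<close>)
    then have "dist (Abs_schreier y) x < e" using \<open>e > 0\<close> by (simp add: dist_norm)
    then show ?thesis using y(1) by blast
  qed
  then show ?thesis by (auto simp: closure_approachable)
qed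


section \<open>The \<open>\<lambda>\<close>-property\<close>

definition lambda_triple :: "'a::real_normed_vector \<Rightarrow> 'a \<Rightarrow> real \<Rightarrow> 'a \<Rightarrow> bool" where
  "lambda_triple e z l y \<longleftrightarrow>
     e extreme_point_of cball 0 1 \<and> z \<in> cball 0 1 \<and> 0 < l \<and> l \<le> 1 \<and>
     y = l *\<^sub>R e + (1 - l) *\<^sub>R z"

text \<open>
  Inserting \<open>0\<close> gives the supremum of the empty set, which is unspecified for reals, the value \<open>0\<close>;
  otherwise it has no effect, all competing values being positive.
\<close>

definition lambda_fun :: "'a::real_normed_vector \<Rightarrow> real" where
  "lambda_fun y = Sup (insert 0 {l. \<exists>e z. lambda_triple e z l y})"

definition uniform_lambda_property :: "'a::real_normed_vector itself \<Rightarrow> bool" where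
  "uniform_lambda_property _ \<longleftrightarrow> (\<exists>l0>0. \<forall>y \<in> cball (0::'a) 1. lambda_fun y \<ge> l0)"

end

theory Submission
  imports Defs "HOL-Library.Discrete_Functions"
begin

text \<open>
  The sequence \<open>x j = 2^-k\<close> for \<open>2^k \<le> j < 2^(k+1)\<close> sums to \<open>1\<close> over every dyadic block and has
  norm \<open>1\<close>. Truncated to \<open>j < 2^m\<close> it norms the average \<open>y\<close> of the \<open>m\<close> indicators of the dyadic
  blocks, all of whose coordinates are \<open>1 / m\<close>. If \<open>y = l e + (1 - l) z\<close>, then \<open>x\<close> also norms \<open>e\<close> and
  (unless \<open>l = 1\<close>) \<open>z\<close>. So \<open>z\<close> has nonnegative coordinates on the support of \<open>x\<close>, while \<open>e\<close> has a positive
  one, which is at least \<open>1\<close> because \<open>e\<close> is extreme. Comparing that coordinate on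
  both sides gives \<open>l \<le> 1 / m\<close>.
\<close>

section \<open>Sublinear functionals\<close>

text \<open>Homogeneity is asked as an inequality only, which is the form that infima yield
  directly; equality follows by rescaling with \<open>inverse c\<close>.\<close>

definition sublinear :: "('a::real_vector \<Rightarrow> real) \<Rightarrow> bool" where
  "sublinear p \<longleftrightarrow> (\<forall>x y. p (x + y) \<le> p x + p y) \<and> (\<forall>c>0. \<forall>x. p (c *\<^sub>R x) \<le> c * p x)"

lemma sublinearI:
  assumes "\<And>x y. p (x + y) \<le> p x + p y" and "\<And>c x. c > 0 \<Longrightarrow> p (c *\<^sub>R x) \<le> c * p x"
  shows "sublinear p"
  using assms by (simp add: sublinear_def)

lemma sublinear_add: "sublinear p \<Longrightarrow> p (x + y) \<le> p x + p y"
  by (simp add: sublinear_def)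

lemma sublinear_scaleR:
  assumes "sublinear p" and "c > 0"
  shows "p (c *\<^sub>R x) = c * p x"
proof -
  have "p (inverse c *\<^sub>R (c *\<^sub>R x)) \<le> inverse c * p (c *\<^sub>R x)"
    using assms unfolding sublinear_def by (metis inverse_positive_iff_positive)
  then have "p x \<le> inverse c * p (c *\<^sub>R x)" using \<open>c > 0\<close> by simp
  then have "c * p x \<le> p (c *\<^sub>R x)" using \<open>c > 0\<close> by (simp add: field_simps)
  moreover have "p (c *\<^sub>R x) \<le> c * p x" using assms by (simp add: sublinear_def)
  ultimately show ?thesis by linarith
qed

lemma sublinear_zero: "sublinear p \<Longrightarrow> p 0 = 0"
  using sublinear_scaleR[of p 2 0] by simp

lemma sublinear_uminus_le: "sublinear p \<Longrightarrow> - p (- x) \<le> p x"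
  using sublinear_add[of p x "- x"] by (simp add: sublinear_zero)

text \<open>Superadditivity makes \<open>p\<close> additive, hence odd, and oddness carries
  homogeneity from positive to negative scalars.\<close>

lemma sublinear_imp_linear:
  assumes p: "sublinear p" and sup: "\<And>x y. p x + p y \<le> p (x + y)"
  shows "linear p"
proof (rule linearI)
  show add: "p (x + y) = p x + p y" for x y
    using sublinear_add[OF p, of x y] sup[of x y] by linarith
  have minus: "p (- x) = - p x" for x
    using add[of x "- x"] by (simp add: sublinear_zero[OF p])
  show "p (c *\<^sub>R x) = c *\<^sub>R p x" for c x
  proof (cases c "0 :: real" rule: linorder_cases)
    case less
    then show ?thesis
      using sublinear_scaleR[OF p, of "- c" x] minus[of "c *\<^sub>R x"] by simp
  qed (simp_all add: sublinear_zero[OF p] sublinear_scaleR[OF p])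
qed

text \<open>Partial minimisation over a convex cone keeps joint sublinearity. The cone is a
  half-line below, where minimality is exploited, and the whole space where a functional is
  split.\<close>

lemma sublinear_INF:
  fixes \<Phi> :: "'a::real_vector \<Rightarrow> 'b::real_vector \<Rightarrow> real"
  assumes ne: "K \<noteq> {}"
    and K_add: "\<And>s t. s \<in> K \<Longrightarrow> t \<in> K \<Longrightarrow> s + t \<in> K"
    and K_scale: "\<And>c t. c > 0 \<Longrightarrow> t \<in> K \<Longrightarrow> c *\<^sub>R t \<in> K"
    and bdd: "\<And>x. bdd_below (\<Phi> x ` K)"
    and add: "\<And>x y s t. s \<in> K \<Longrightarrow> t \<in> K \<Longrightarrow> \<Phi> (x + y) (s + t) \<le> \<Phi> x s + \<Phi> y t"
    and scale: "\<And>c x t. c > 0 \<Longrightarrow> t \<in> K \<Longrightarrow> \<Phi> (c *\<^sub>R x) (c *\<^sub>R t) \<le> c * \<Phi> x t"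
  shows "sublinear (\<lambda>x. INF t\<in>K. \<Phi> x t)"
proof (rule sublinearI)
  fix x y
  have "(INF t\<in>K. \<Phi> (x + y) t) - \<Phi> y t \<le> (INF s\<in>K. \<Phi> x s)" if t: "t \<in> K" for t
  proof (rule cINF_greatest[OF ne])
    fix s assume s: "s \<in> K"
    have "(INF t\<in>K. \<Phi> (x + y) t) \<le> \<Phi> (x + y) (s + t)"
      by (intro cINF_lower bdd K_add s t)
    then show "(INF t\<in>K. \<Phi> (x + y) t) - \<Phi> y t \<le> \<Phi> x s" using add[OF s t, of x y] by linarith
  qed
  then have "(INF t\<in>K. \<Phi> (x + y) t) - (INF s\<in>K. \<Phi> x s) \<le> (INF t\<in>K. \<Phi> y t)"
    by (intro cINF_greatest[OF ne]) (simp add: algebra_simps)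
  then show "(INF t\<in>K. \<Phi> (x + y) t) \<le> (INF t\<in>K. \<Phi> x t) + (INF t\<in>K. \<Phi> y t)" by linarith
next
  fix c :: real and x assume c: "c > 0"
  have "(INF t\<in>K. \<Phi> (c *\<^sub>R x) t) / c \<le> (INF t\<in>K. \<Phi> x t)"
  proof (rule cINF_greatest[OF ne])
    fix t assume t: "t \<in> K"
    have "(INF t\<in>K. \<Phi> (c *\<^sub>R x) t) \<le> \<Phi> (c *\<^sub>R x) (c *\<^sub>R t)"
      by (intro cINF_lower bdd K_scale c t)
    then have "(INF t\<in>K. \<Phi> (c *\<^sub>R x) t) \<le> c * \<Phi> x t" using scale[OF c t, of x] by linarith
    then show "(INF t\<in>K. \<Phi> (c *\<^sub>R x) t) / c \<le> \<Phi> x t" using c by (simp add: field_simps)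
  qed
  then show "(INF t\<in>K. \<Phi> (c *\<^sub>R x) t) \<le> c * (INF t\<in>K. \<Phi> x t)" using c by (simp add: field_simps)
qed

text \<open>Pointwise infima of sublinear functionals need not be subadditive. In a chain, the
  smaller \<open>r\<close> of \<open>p\<close> and \<open>q\<close> satisfies
  \<open>r (x + y) \<le> p x + q y\<close>.\<close>

lemma sublinear_chain_INF:
  fixes C :: "('a::real_vector \<Rightarrow> real) set"
  assumes ne: "C \<noteq> {}"
    and sub: "\<And>p. p \<in> C \<Longrightarrow> sublinear p"
    and bdd: "\<And>x. bdd_below ((\<lambda>p. p x) ` C)"
    and chain: "\<And>p q. p \<in> C \<Longrightarrow> q \<in> C \<Longrightarrow> p \<le> q \<or> q \<le> p"
  shows "sublinear (\<lambda>x. INF p\<in>C. p x)"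
proof (rule sublinearI)
  fix x y
  have le: "(INF p\<in>C. p (x + y)) \<le> p x + q y" if pq: "p \<in> C" "q \<in> C" for p q
  proof -
    obtain r where r: "r \<in> C" "r \<le> p" "r \<le> q" using chain[OF pq] pq by blast
    have "(INF p\<in>C. p (x + y)) \<le> r (x + y)" by (intro cINF_lower bdd r)
    also have "\<dots> \<le> r x + r y" by (rule sublinear_add[OF sub[OF r(1)]])
    also have "\<dots> \<le> p x + q y" using r by (intro add_mono) (auto simp: le_fun_def)
    finally show ?thesis .
  qed
  have "(INF p\<in>C. p (x + y)) - q y \<le> (INF p\<in>C. p x)" if "q \<in> C" for q
    using le[OF _ that] by (intro cINF_greatest[OF ne]) (simp add: algebra_simps)
  then have "(INF p\<in>C. p (x + y)) - (INF p\<in>C. p x) \<le> (INF p\<in>C. p y)"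
    by (intro cINF_greatest[OF ne]) (simp add: algebra_simps)
  then show "(INF p\<in>C. p (x + y)) \<le> (INF p\<in>C. p x) + (INF p\<in>C. p y)" by linarith
next
  fix c :: real and x assume c: "c > 0"
  have "(INF p\<in>C. p (c *\<^sub>R x)) / c \<le> (INF p\<in>C. p x)"
  proof (rule cINF_greatest[OF ne])
    fix p assume p: "p \<in> C"
    have "(INF p\<in>C. p (c *\<^sub>R x)) \<le> p (c *\<^sub>R x)" by (intro cINF_lower bdd p)
    then show "(INF p\<in>C. p (c *\<^sub>R x)) / c \<le> p x"
      using sublinear_scaleR[OF sub[OF p] c] c by (simp add: field_simps)
  qed
  then show "(INF p\<in>C. p (c *\<^sub>R x)) \<le> c * (INF p\<in>C. p x)" using c by (simp add: field_simps)
qed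

text \<open>Zorn's lemma in the reversed order: the pointwise infimum of a chain is again sublinear
  and lies below \<open>q\<close>.\<close>

lemma ex_minimal_sublinear:
  fixes q :: "'a::real_vector \<Rightarrow> real"
  assumes q: "sublinear q"
  obtains p where "sublinear p" "p \<le> q" "\<And>r. sublinear r \<Longrightarrow> r \<le> p \<Longrightarrow> r = p"
proof -
  define A where "A = {p. sublinear p \<and> p \<le> q}"
  have "\<exists>m\<in>A. \<forall>a\<in>A. m \<ge> a \<longrightarrow> a = m"
  proof (rule predicate_Zorn)
    show "partial_order_on A (relation_of (\<ge>) A)"
      by (rule partial_order_on_relation_ofI) auto
    fix C assume C: "C \<in> Chains (relation_of (\<ge>) A)"
    then have CA: "C \<subseteq> A" and chain: "\<And>p r. p \<in> C \<Longrightarrow> r \<in> C \<Longrightarrow> p \<le> r \<or> r \<le> p"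
      unfolding Chains_def relation_of_def by auto
    show "\<exists>u\<in>A. \<forall>a\<in>C. a \<ge> u"
    proof (cases "C = {}")
      case True
      then show ?thesis using q by (auto simp: A_def)
    next
      case False
      \<comment> \<open>This bound is the same for all members of the chain, so the real infimum is
        a genuine one.\<close>
      have low: "- q (- x) \<le> p x" if "p \<in> C" for p x
      proof -
        have "sublinear p" "p (- x) \<le> q (- x)" using that CA by (auto simp: A_def le_fun_def)
        then show ?thesis using sublinear_uminus_le[of p x] by linarith
      qed
      have bdd: "bdd_below ((\<lambda>p. p x) ` C)" for x
        using low by (auto intro!: bdd_belowI2)
      define u where "u x = (INF p\<in>C. p x)" for x
      have "sublinear u"
        unfolding u_def using CA by (intro sublinear_chain_INF False bdd chain) (auto simp: A_def)
      moreover have u_le: "u \<le> p" if "p \<in> C" for p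
        unfolding u_def le_fun_def using that bdd by (auto intro: cINF_lower)
      ultimately show ?thesis using False CA by (force simp: A_def)
    qed
  qed
  then show ?thesis using that unfolding A_def by (metis (no_types, lifting) mem_Collect_eq order_trans)
qed

text \<open>A minimal sublinear functional is linear.\<close>

theorem ex_linear_le_sublinear:
  fixes q :: "'a::real_vector \<Rightarrow> real"
  assumes "sublinear q"
  obtains g where "linear g" "\<And>x. g x \<le> q x"
proof -
  obtain p where p: "sublinear p" "p \<le> q" and min: "\<And>r. sublinear r \<Longrightarrow> r \<le> p \<Longrightarrow> r = p"
    using ex_minimal_sublinear[OF assms] by blast
  have "p x + p a \<le> p (x + a)" for x a
  proof -
    \<comment> \<open>This sublinear functional lies below \<open>p\<close> by \<open>t = 0\<close>,
      so it equals \<open>p\<close> by minimality. Then \<open>t = 1\<close> gives the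
      claim.\<close>
    define r where "r x = (INF t\<in>{0::real..}. p (x + t *\<^sub>R a) - t * p a)" for x
    have p_scale: "p (t *\<^sub>R a) = t * p a" if "t \<ge> 0" for t
      using that sublinear_scaleR[OF p(1), of t a] sublinear_zero[OF p(1)]
      by (cases "t = 0") auto
    have bdd: "bdd_below ((\<lambda>t. p (x + t *\<^sub>R a) - t * p a) ` {0..})" for x
    proof (rule bdd_belowI2)
      fix t :: real assume "t \<in> {0..}"
      then show "- p (- x) \<le> p (x + t *\<^sub>R a) - t * p a"
        using sublinear_add[OF p(1), of "x + t *\<^sub>R a" "- x"] p_scale[of t] by simp
    qed
    have "sublinear r"
      unfolding r_def
    proof (rule sublinear_INF)
      fix x y and s t :: real
      show "p (x + y + (s + t) *\<^sub>R a) - (s + t) * p a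
          \<le> p (x + s *\<^sub>R a) - s * p a + (p (y + t *\<^sub>R a) - t * p a)"
        using sublinear_add[OF p(1), of "x + s *\<^sub>R a" "y + t *\<^sub>R a"] by (simp add: algebra_simps)
    next
      fix c t :: real and x assume "c > 0"
      then show "p (c *\<^sub>R x + (c *\<^sub>R t) *\<^sub>R a) - c *\<^sub>R t * p a \<le> c * (p (x + t *\<^sub>R a) - t * p a)"
        using sublinear_scaleR[OF p(1), of c "x + t *\<^sub>R a"] by (simp add: algebra_simps)
    qed (auto intro: bdd)
    moreover have "r \<le> p"
      unfolding r_def le_fun_def using cINF_lower[OF bdd, of 0] by auto
    ultimately have "r = p" by (rule min)
    moreover have "r x \<le> p (x + a) - p a"
      unfolding r_def using cINF_lower[OF bdd, of 1 x] by simp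
    ultimately show ?thesis by simp
  qed
  then have "linear p" by (rule sublinear_imp_linear[OF p(1)])
  then show ?thesis using p(2) that by (auto simp: le_fun_def)
qed


section \<open>Extreme functionals for a norm that is a maximum\<close>

text \<open>
  The functional \<open>f\<close> splits as \<open>g + h\<close> with \<open>g x + h y \<le> max (q1 x) (q2 y)\<close>. Testing
  with multiples of \<open>a\<close> separates the two terms: \<open>g \<le> p * q1\<close> and \<open>h \<le> (1 - p) * q2\<close>, where
  \<open>p = g a\<close>.
\<close>

lemma extreme_functional_ge_1:
  fixes f :: "'a::real_normed_vector \<Rightarrow>\<^sub>L real"
  assumes q: "sublinear q1" "sublinear q2" "\<And>x. q1 x \<le> norm x" "\<And>x. q2 x \<le> norm x"
    and norm_le: "\<And>x. norm x \<le> max (q1 x) (q2 x)"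
    and q1_shift: "\<And>x t. q1 (x + t *\<^sub>R a) \<le> q1 x + t"
    and q2_a: "q2 a \<le> 0"
    and ext: "f extreme_point_of cball 0 1"
    and pos: "blinfun_apply f a > 0"
  shows "blinfun_apply f a \<ge> 1"
proof (rule ccontr)
  assume "\<not> ?thesis"
  then have lt1: "blinfun_apply f a < 1" by simp
  have nf: "norm f \<le> 1" using ext by (simp add: extreme_point_of_def)
  have f_le: "blinfun_apply f x \<le> norm x" for x
  proof -
    have "blinfun_apply f x \<le> norm f * norm x"
      using norm_blinfun[of f x] by simp
    also have "\<dots> \<le> 1 * norm x" using nf by (intro mult_right_mono) auto
    finally show ?thesis by simp
  qed
  \<comment> \<open>If a linear \<open>g\<close> lies below \<open>Q\<close> and
    \<open>h = f - g\<close>, then \<open>z = x - y\<close> gives the splitting inequality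
    \<open>g x + h y \<le> max (q1 x) (q2 y)\<close>.\<close>
  define Q where "Q z = (INF y\<in>UNIV. max (q1 (z + y)) (q2 y) - blinfun_apply f y)" for z
  \<comment> \<open>By \<open>norm_le\<close>, \<open>f y \<le> max (q1 y) (q2 y)\<close>, and
    passing from \<open>q1 y\<close> to \<open>q1 (z + y)\<close> costs at most
    \<open>norm z\<close>.\<close>
  have bdd: "bdd_below (range (\<lambda>y. max (q1 (z + y)) (q2 y) - blinfun_apply f y))" for z
  proof (rule bdd_belowI2)
    fix y
    have "q1 y \<le> q1 (z + y) + norm z"
      using sublinear_add[OF q(1), of "z + y" "- z"] q(3)[of "- z"] by simp
    then show "- norm z \<le> max (q1 (z + y)) (q2 y) - blinfun_apply f y"
      using f_le[of y] norm_le[of y] norm_ge_zero[of z] by linarith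
  qed
  have "sublinear Q"
    unfolding Q_def
  proof (rule sublinear_INF)
    fix x y s t
    show "max (q1 (x + y + (s + t))) (q2 (s + t)) - blinfun_apply f (s + t)
        \<le> max (q1 (x + s)) (q2 s) - blinfun_apply f s
          + (max (q1 (y + t)) (q2 t) - blinfun_apply f t)"
      using sublinear_add[OF q(1), of "x + s" "y + t"] sublinear_add[OF q(2), of s t]
      by (simp add: blinfun.bilinear_simps algebra_simps max_def)
  next
    fix c :: real and x t assume c: "c > 0"
    have "q1 (c *\<^sub>R x + c *\<^sub>R t) = c * q1 (x + t)"
      using sublinear_scaleR[OF q(1) c, of "x + t"] by (simp add: scaleR_add_right)
    then show "max (q1 (c *\<^sub>R x + c *\<^sub>R t)) (q2 (c *\<^sub>R t)) - blinfun_apply f (c *\<^sub>R t)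
        \<le> c * (max (q1 (x + t)) (q2 t) - blinfun_apply f t)"
      using c sublinear_scaleR[OF q(2) c, of t]
      by (simp add: blinfun.bilinear_simps algebra_simps max_mult_distrib_left)
  qed (use bdd in auto)
  then obtain g where lin: "linear g" and "\<And>x. g x \<le> Q x"
    using ex_linear_le_sublinear by blast
  then have g_le: "g z \<le> max (q1 (z + y)) (q2 y) - blinfun_apply f y" for z y
    unfolding Q_def using cINF_lower[OF bdd, of y z] by (meson UNIV_I order_trans)
  define p where "p = g a"
  define h where "h x = blinfun_apply f x - g x" for x
  have h_lin: "linear h"
    unfolding h_def by (intro linear_compose_sub lin) (rule bounded_linear.linear[OF blinfun.bounded_linear_right])
  have q0: "q1 0 = 0" "q2 0 = 0" using q by (simp_all add: sublinear_zero)
  \<comment> \<open>Shifting \<open>x\<close> by \<open>- q1 x\<close> times \<open>a\<close> brings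
    \<open>q1\<close> down to at most \<open>0\<close>, and there \<open>g\<close> is
    nonpositive.\<close>
  have g_q1: "g x \<le> p * q1 x" for x
  proof -
    have "g (x + (- q1 x) *\<^sub>R a) \<le> max (q1 (x + (- q1 x) *\<^sub>R a)) 0"
      using g_le[of "x + (- q1 x) *\<^sub>R a" 0] q0 by simp
    also have "\<dots> \<le> 0" using q1_shift[of x "- q1 x"] by simp
    finally show ?thesis by (simp add: linear_diff[OF lin] linear_scale[OF lin] p_def mult.commute)
  qed
  have h_t: "h y + t * p \<le> max t (q2 y)" for y t
  proof -
    have "g (t *\<^sub>R a - y) \<le> max (q1 (t *\<^sub>R a)) (q2 y) - blinfun_apply f y"
      using g_le[of "t *\<^sub>R a - y" y] by simp
    moreover have "q1 (t *\<^sub>R a) \<le> t" using q1_shift[of 0 t] q0 by simp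
    ultimately show ?thesis
      by (simp add: linear_diff[OF lin] linear_scale[OF lin] p_def h_def max_def split: if_splits)
  qed
  \<comment> \<open>The choice \<open>t = q2 y\<close> makes both arguments of the maximum
    equal.\<close>
  have h_q2: "h y \<le> (1 - p) * q2 y" for y
    using h_t[of y "q2 y"] by (simp add: algebra_simps)
  have h0: "h 0 = 0" by (rule linear_0[OF h_lin])
  have p1: "p \<le> 1" using h_t[of 0 1] by (simp add: h0 q0)
  have "h a \<le> 0"
    using h_q2[of a] mult_nonneg_nonpos[of "1 - p" "q2 a"] p1 q2_a by linarith
  then have p_pos: "p > 0" using pos unfolding h_def p_def by linarith
  \<comment> \<open>For \<open>p = 1\<close> the bound on \<open>h\<close> becomes \<open>0\<close>,
    so \<open>h a \<ge> 0\<close> and \<open>f a = 1 + h a \<ge> 1\<close>, against the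
    assumption.\<close>
  have "p \<noteq> 1"
  proof
    assume "p = 1"
    then have "h (- a) \<le> 0" using h_q2[of "- a"] by simp
    then have "h a \<ge> 0" by (simp add: linear_neg[OF h_lin])
    then show False using \<open>p = 1\<close> lt1 unfolding h_def p_def by linarith
  qed
  with p1 have p_lt: "p < 1" by simp
  have dominated: "bounded_linear k" "norm (Blinfun k) \<le> 1"
    if k: "linear k" "\<And>x. k x \<le> norm x" for k :: "'a \<Rightarrow> real"
  proof -
    have abs_k: "norm (k x) \<le> norm x" for x
      using k(2)[of x] k(2)[of "- x"] by (simp add: linear_neg[OF k(1)] abs_le_iff)
    show bl: "bounded_linear k"
      using k(1) abs_k by (auto simp: bounded_linear_def bounded_linear_axioms_def intro!: exI[of _ 1])
    show "norm (Blinfun k) \<le> 1"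
      using abs_k bl by (intro norm_blinfun_bound) (simp_all add: bounded_linear_Blinfun_apply)
  qed
  \<comment> \<open>Normalising the two parts exhibits \<open>f\<close> as a convex combination of
    members of the dual ball with weights \<open>p\<close> and \<open>1 - p\<close>.\<close>
  define u where "u x = (1 / p) * g x" for x
  define v where "v x = (1 / (1 - p)) * h x" for x
  have u_q1: "u x \<le> q1 x" and v_q2: "v x \<le> q2 x" for x
    using g_q1[of x] h_q2[of x] p_pos p_lt by (simp_all add: u_def v_def field_simps)
  have "linear u" "linear v"
    unfolding u_def v_def
    using linear_compose_scale_right[OF lin, of "1 / p"]
      linear_compose_scale_right[OF h_lin, of "1 / (1 - p)"] by simp_all
  moreover have "u x \<le> norm x" "v x \<le> norm x" for x
    using u_q1[of x] v_q2[of x] q(3,4)[of x] by linarith+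
  ultimately have bl: "bounded_linear u" "bounded_linear v"
    and nrm: "norm (Blinfun u) \<le> 1" "norm (Blinfun v) \<le> 1"
    using dominated by blast+
  \<comment> \<open>The values at \<open>a\<close> tell \<open>u\<close> and \<open>v\<close> apart:
    at least \<open>1\<close> against at most \<open>0\<close>.\<close>
  have "u (- a) \<le> - 1" using u_q1[of "- a"] q1_shift[of 0 "- 1"] q0 by simp
  then have "u a \<ge> 1" by (simp add: linear_neg[OF \<open>linear u\<close>])
  moreover have "v a \<le> 0" using v_q2[of a] q2_a by linarith
  ultimately have "Blinfun u \<noteq> Blinfun v"
    using bl by (metis bounded_linear_Blinfun_apply not_one_le_zero order_trans)
  moreover have "f = (1 - p) *\<^sub>R Blinfun v + p *\<^sub>R Blinfun u"
    using bl p_pos p_lt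
    by (intro blinfun_eqI) (simp add: blinfun.bilinear_simps bounded_linear_Blinfun_apply u_def v_def h_def)
  ultimately have "f \<in> open_segment (Blinfun v) (Blinfun u)"
    using p_pos p_lt by (auto simp: in_segment)
  then show False using ext nrm by (auto simp: extreme_point_of_def)
qed


section \<open>Sublinear functionals on the Schreier space\<close>

text \<open>With all admissible sets and absolute values this is the norm. Restricting the sets, or
  the signs through \<open>\<phi>\<close>, yields the two parts into which the norm is divided
  below.\<close>

definition family_sup :: "nat set set \<Rightarrow> (nat \<Rightarrow> real \<Rightarrow> real) \<Rightarrow> schreier \<Rightarrow> real" where
  "family_sup \<F> \<phi> x = (SUP F\<in>\<F>. \<Sum>j\<in>F. \<phi> j (Rep_schreier x j))"

context
  fixes \<F> :: "nat set set" and \<phi> :: "nat \<Rightarrow> real \<Rightarrow> real"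
  assumes \<F>: "\<F> \<noteq> {}" "\<F> \<subseteq> Collect admissible"
    and \<phi>_le: "\<forall>j t. \<phi> j t \<le> \<bar>t\<bar>"
begin

lemma family_term_le_norm: "F \<in> \<F> \<Longrightarrow> (\<Sum>j\<in>F. \<phi> j (Rep_schreier x j)) \<le> norm x"
  using \<F>(2) \<phi>_le by (intro order_trans[OF sum_mono sum_le_norm_schreier]) auto

lemma family_term_le: "F \<in> \<F> \<Longrightarrow> (\<Sum>j\<in>F. \<phi> j (Rep_schreier x j)) \<le> family_sup \<F> \<phi> x"
  unfolding family_sup_def
  by (intro cSUP_upper bdd_aboveI2[where M = "norm x"] family_term_le_norm)

lemma family_sup_le:
  "(\<And>F. F \<in> \<F> \<Longrightarrow> (\<Sum>j\<in>F. \<phi> j (Rep_schreier x j)) \<le> c) \<Longrightarrow> family_sup \<F> \<phi> x \<le> c"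
  unfolding family_sup_def by (intro cSUP_least \<F>)

lemma family_sup_le_norm: "family_sup \<F> \<phi> x \<le> norm x"
  by (intro family_sup_le family_term_le_norm)

lemma sublinear_family_sup:
  assumes "\<And>j. sublinear (\<phi> j)"
  shows "sublinear (family_sup \<F> \<phi>)"
proof (rule sublinearI)
  fix x y
  show "family_sup \<F> \<phi> (x + y) \<le> family_sup \<F> \<phi> x + family_sup \<F> \<phi> y"
  proof (rule family_sup_le)
    fix F assume F: "F \<in> \<F>"
    have "(\<Sum>j\<in>F. \<phi> j (Rep_schreier (x + y) j))
        \<le> (\<Sum>j\<in>F. \<phi> j (Rep_schreier x j) + \<phi> j (Rep_schreier y j))"
      by (intro sum_mono) (simp add: Rep_schreier_simps sublinear_add[OF assms])
    also have "\<dots> \<le> family_sup \<F> \<phi> x + family_sup \<F> \<phi> y"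
      using family_term_le[OF F, of x] family_term_le[OF F, of y] by (simp add: sum.distrib)
    finally show "(\<Sum>j\<in>F. \<phi> j (Rep_schreier (x + y) j)) \<le> family_sup \<F> \<phi> x + family_sup \<F> \<phi> y" .
  qed
next
  fix c :: real and x assume c: "c > 0"
  show "family_sup \<F> \<phi> (c *\<^sub>R x) \<le> c * family_sup \<F> \<phi> x"
  proof (rule family_sup_le)
    fix F assume F: "F \<in> \<F>"
    have "(\<Sum>j\<in>F. \<phi> j (Rep_schreier (c *\<^sub>R x) j)) = c * (\<Sum>j\<in>F. \<phi> j (Rep_schreier x j))"
      using sublinear_scaleR[OF assms c] by (simp add: Rep_schreier_simps sum_distrib_left)
    then show "(\<Sum>j\<in>F. \<phi> j (Rep_schreier (c *\<^sub>R x) j)) \<le> c * family_sup \<F> \<phi> x"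
      using family_term_le[OF F, of x] c by simp
  qed
qed

end

section \<open>Coordinates of extreme functionals\<close>

definition unit_vec :: "nat \<Rightarrow> schreier" where
  "unit_vec i = Abs_schreier (\<lambda>j. if j = i then 1 else 0)"

lemma Rep_unit_vec: "i > 0 \<Longrightarrow> Rep_schreier (unit_vec i) j = (if j = i then 1 else 0)"
  unfolding unit_vec_def by (subst Rep_schreier_c00) (auto simp: c00_def)

text \<open>
  The norming functionals \<open>\<Sum>j\<in>F. \<plusminus>x j\<close> are divided according to whether the coordinate at \<open>i\<close> is \<open>1\<close>
  or one of \<open>0\<close> and \<open>-1\<close>; each part has its supremum as a sublinear functional.
\<close>

lemma extreme_coord_ge_1:
  fixes f :: "schreier \<Rightarrow>\<^sub>L real"
  assumes i: "i > 0" and ext: "f extreme_point_of cball 0 1"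
    and pos: "blinfun_apply f (unit_vec i) > 0"
  shows "blinfun_apply f (unit_vec i) \<ge> 1"
proof -
  \<comment> \<open>Every set contains \<open>i\<close>, where \<open>\<phi>1\<close> keeps the
    sign, so adding \<open>t\<close> times \<open>unit_vec i\<close> shifts every sum by exactly
    \<open>t\<close>.\<close>
  define \<F>1 where "\<F>1 = {F. admissible F \<and> i \<in> F}"
  define \<phi>1 where "\<phi>1 j t = (if j = i then t else \<bar>t\<bar>)" for j and t :: real
  \<comment> \<open>The term at \<open>i\<close> is the larger of \<open>0\<close> and
    \<open>- t\<close>, so the resulting functional vanishes at \<open>unit_vec i\<close>.\<close>
  define \<phi>2 where "\<phi>2 j t = (if j = i then max 0 (- t) else \<bar>t\<bar>)" for j and t :: real
  have 1: "\<F>1 \<noteq> {}" "\<F>1 \<subseteq> Collect admissible" "\<forall>j t. \<phi>1 j t \<le> \<bar>t\<bar>"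
    using i by (auto simp: \<F>1_def \<phi>1_def intro: admissible_single[OF i])
  have 2: "Collect admissible \<noteq> {}" "Collect admissible \<subseteq> Collect admissible"
    "\<forall>j t. \<phi>2 j t \<le> \<bar>t\<bar>"
    by (auto simp: \<phi>2_def intro: admissible_empty)
  note term1 = family_term_le[OF 1] and term2 = family_term_le[OF 2]
  have sub: "sublinear (\<phi>1 j)" "sublinear (\<phi>2 j)" for j
    by (auto intro!: sublinearI simp: \<phi>1_def \<phi>2_def abs_mult max_def mult_le_0_iff zero_le_mult_iff)
  show ?thesis
  proof (rule extreme_functional_ge_1[OF sublinear_family_sup[OF 1 sub(1)]
        sublinear_family_sup[OF 2 sub(2)] family_sup_le_norm[OF 1] family_sup_le_norm[OF 2]
        _ _ _ ext pos])
    fix x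
    show "norm x \<le> max (family_sup \<F>1 \<phi>1 x) (family_sup (Collect admissible) \<phi>2 x)"
    proof (rule norm_schreier_leI)
      fix F assume F: "admissible F"
      show "(\<Sum>j\<in>F. \<bar>Rep_schreier x j\<bar>)
          \<le> max (family_sup \<F>1 \<phi>1 x) (family_sup (Collect admissible) \<phi>2 x)"
      \<comment> \<open>Otherwise \<open>i\<close> is not in \<open>F\<close> or its coordinate is
        negative, and \<open>\<phi>2\<close> gives the absolute value throughout
        \<open>F\<close>.\<close>
      proof (cases "i \<in> F \<and> Rep_schreier x i \<ge> 0")
        case True
        then have "(\<Sum>j\<in>F. \<bar>Rep_schreier x j\<bar>) = (\<Sum>j\<in>F. \<phi>1 j (Rep_schreier x j))"
          by (intro sum.cong) (auto simp: \<phi>1_def)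
        then show ?thesis using term1[of F x] True F by (simp add: \<F>1_def)
      next
        case False
        then have "(\<Sum>j\<in>F. \<bar>Rep_schreier x j\<bar>) = (\<Sum>j\<in>F. \<phi>2 j (Rep_schreier x j))"
          by (intro sum.cong) (auto simp: \<phi>2_def)
        then show ?thesis using term2[of F x] F by simp
      qed
    qed
  next
    fix x t
    show "family_sup \<F>1 \<phi>1 (x + t *\<^sub>R unit_vec i) \<le> family_sup \<F>1 \<phi>1 x + t"
    proof (rule family_sup_le[OF 1])
      fix F assume F: "F \<in> \<F>1"
      then have fin: "finite F" and iF: "i \<in> F" by (auto simp: \<F>1_def admissible_def)
      have "(\<Sum>j\<in>F. \<phi>1 j (Rep_schreier (x + t *\<^sub>R unit_vec i) j))
          = (\<Sum>j\<in>F. \<phi>1 j (Rep_schreier x j) + (if j = i then t else 0))"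
        using i by (intro sum.cong) (auto simp: Rep_schreier_simps Rep_unit_vec \<phi>1_def)
      also have "\<dots> = (\<Sum>j\<in>F. \<phi>1 j (Rep_schreier x j)) + t"
        using fin iF by (simp add: sum.distrib)
      finally show "(\<Sum>j\<in>F. \<phi>1 j (Rep_schreier (x + t *\<^sub>R unit_vec i) j))
          \<le> family_sup \<F>1 \<phi>1 x + t"
        using term1[OF F, of x] by linarith
    qed
  next
    have "\<phi>2 j (Rep_schreier (unit_vec i) j) = 0" for j
      using i by (simp add: Rep_unit_vec \<phi>2_def)
    then show "family_sup (Collect admissible) \<phi>2 (unit_vec i) \<le> 0"
      by (intro family_sup_le[OF 2]) simp
  qed
qed


section \<open>The dyadic vector and functional\<close>

definition dyadic_vec :: "nat \<Rightarrow> schreier" where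
  "dyadic_vec m = Abs_schreier (\<lambda>j. if j \<in> {1..<2^m} then 1 / 2 ^ floor_log j else 0)"

lemma Rep_dyadic_vec:
  "Rep_schreier (dyadic_vec m) j = (if j \<in> {1..<2^m} then 1 / 2 ^ floor_log j else 0)"
  unfolding dyadic_vec_def
  by (subst Rep_schreier_c00) (auto simp: c00_def intro: finite_subset[of _ "{1..<2^m}"])

text \<open>Let \<open>2^k \<le> Min F < 2^(k+1)\<close>. In units of \<open>2^-(k+1)\<close>,
  elements of \<open>F\<close> below \<open>2^(k+1)\<close> weigh at most two and the others at most
  one. The former number at most \<open>2^(k+1) - Min F\<close>, and \<open>F\<close> has at most
  \<open>Min F\<close> elements in all, so the total is at most \<open>2^(k+1)\<close>
  units.\<close>

lemma norm_dyadic_vec: "norm (dyadic_vec m) \<le> 1"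
proof (rule norm_schreier_leI)
  fix F assume F: "admissible F"
  show "(\<Sum>j\<in>F. \<bar>Rep_schreier (dyadic_vec m) j\<bar>) \<le> 1"
  proof (cases "F = {}")
    case False
    define a where "a = Min F"
    define k where "k = floor_log a"
    have fin: "finite F" and card: "card F \<le> a" and a: "a \<in> F" "a > 0" and
      min: "\<And>j. j \<in> F \<Longrightarrow> a \<le> j"
      using F False Min_in[of F] by (auto simp: admissible_def a_def intro!: gr0I)
    have k: "2 ^ k \<le> a" "a < 2 * 2 ^ k"
      using a floor_log_exp2_le floor_log_exp2_gt by (auto simp: k_def)
    define G where "G = F \<inter> {..<2 * 2 ^ k}"
    have "G \<subseteq> {a..<2 * 2 ^ k}" using min by (auto simp: G_def)
    from card_mono[OF _ this] have "card G \<le> 2 * 2 ^ k - a" by simp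
    then have cards: "card G + card F \<le> 2 * 2 ^ k" using card k by linarith
    have "\<bar>Rep_schreier (dyadic_vec m) j\<bar> \<le> (1 + indicator G j) / 2 ^ Suc k" if j: "j \<in> F" for j
    proof (cases "j \<in> G")
      case True
      have "k \<le> floor_log j" using min[OF j] floor_log_le_iff by (simp add: k_def)
      then have "(1::real) / 2 ^ floor_log j \<le> 1 / 2 ^ k"
        by (intro divide_left_mono power_increasing) auto
      then show ?thesis using True by (simp add: Rep_dyadic_vec)
    next
      case False
      then have "floor_log (2 ^ Suc k) \<le> floor_log j"
        using j by (intro floor_log_le_iff) (simp add: G_def)
      then have "(1::real) / 2 ^ floor_log j \<le> 1 / 2 ^ Suc k"
        by (intro divide_left_mono power_increasing) (auto simp del: power_Suc)
      then show ?thesis using False by (simp add: Rep_dyadic_vec)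
    qed
    then have "(\<Sum>j\<in>F. \<bar>Rep_schreier (dyadic_vec m) j\<bar>) \<le> (\<Sum>j\<in>F. (1 + indicator G j) / 2 ^ Suc k)"
      by (rule sum_mono)
    also have "\<dots> = (card F + card G) / 2 ^ Suc k"
    proof -
      have "F \<inter> G = G" by (auto simp: G_def)
      then show ?thesis
        using fin by (simp add: sum.distrib indicator_def sum.If_cases of_bool_def flip: sum_divide_distrib)
    qed
    also have "\<dots> \<le> 1"
    proof -
      have "real (card G + card F) \<le> real (2 * 2 ^ k)" using cards by (simp only: of_nat_le_iff)
      then show ?thesis by simp
    qed
    finally show ?thesis .
  qed simp
qed

lemma sum_dyadic_blocks:
  fixes f :: "nat \<Rightarrow> 'a::comm_monoid_add"
  shows "(\<Sum>j\<in>{1..<2^m}. f j) = (\<Sum>k<m. \<Sum>j\<in>{2^k..<2^Suc k}. f j)"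
proof (induction m)
  case (Suc m)
  have "(\<Sum>j\<in>{1..<2^Suc m}. f j) = (\<Sum>j\<in>{1..<2^m}. f j) + (\<Sum>j\<in>{2^m..<2^Suc m}. f j)"
    by (rule sum.atLeastLessThan_concat[symmetric]) auto
  then show ?case using Suc by simp
qed simp

definition dyadic_fun :: "nat \<Rightarrow> schreier \<Rightarrow> real" where
  "dyadic_fun m x = (\<Sum>j\<in>{1..<2^m}. Rep_schreier x j) / m"

text \<open>A dyadic block has as many elements as its minimum, so it is admissible and its sum is
  at most the norm.\<close>

lemma dyadic_fun_le_norm: "\<bar>dyadic_fun m x\<bar> \<le> norm x"
proof (cases "m = 0")
  case False
  have "\<bar>\<Sum>j\<in>{1..<2^m}. Rep_schreier x j\<bar> \<le> (\<Sum>j\<in>{1..<2^m}. \<bar>Rep_schreier x j\<bar>)"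
    by (rule sum_abs)
  also have "\<dots> = (\<Sum>k<m. \<Sum>j\<in>{2^k..<2^Suc k}. \<bar>Rep_schreier x j\<bar>)"
    by (rule sum_dyadic_blocks)
  also have "\<dots> \<le> (\<Sum>k<m. norm x)"
  proof (intro sum_mono sum_le_norm_schreier)
    fix k :: nat
    have "Min {2 ^ k..<2 ^ Suc k} = (2 ^ k :: nat)" by (intro Min_eqI) auto
    then show "admissible {2 ^ k..<2 ^ Suc k}" by (simp add: admissible_def)
  qed
  finally show ?thesis using False by (simp add: dyadic_fun_def field_simps)
qed (simp add: dyadic_fun_def)

lemma bounded_linear_dyadic_fun: "bounded_linear (dyadic_fun m)"
  using dyadic_fun_le_norm[of m]
  by (intro bounded_linear_intro[where K = 1])
    (auto simp: dyadic_fun_def Rep_schreier_simps sum.distrib add_divide_distrib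
      simp flip: sum_distrib_left)

text \<open>Block \<open>k\<close> consists of \<open>2^k\<close> terms \<open>2^-k\<close>, so each
  of the \<open>m\<close> blocks sums to \<open>1\<close>.\<close>

lemma dyadic_fun_dyadic_vec:
  assumes "m > 0"
  shows "dyadic_fun m (dyadic_vec m) = 1"
proof -
  have "(\<Sum>j\<in>{1..<2^m}. Rep_schreier (dyadic_vec m) j) = (\<Sum>j\<in>{1..<2^m}. 1 / 2 ^ floor_log j)"
    by (intro sum.cong) (auto simp: Rep_dyadic_vec)
  also have "\<dots> = (\<Sum>k<m. \<Sum>j\<in>{2^k..<2^Suc k}. 1 / 2 ^ floor_log j)"
    by (rule sum_dyadic_blocks)
  also have "\<dots> = (\<Sum>k<m. 1)"
  proof (rule sum.cong)
    fix k :: nat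
    have "floor_log j = k" if "j \<in> {2 ^ k..<2 ^ Suc k}" for j
      using that by (intro floor_log_eqI) (auto intro: less_le_trans[of 0 "2 ^ k"])
    then have "(\<Sum>j\<in>{2^k..<2^Suc k}. 1 / 2 ^ floor_log j) = (\<Sum>j\<in>{2^k..<2^Suc k::nat}. 1 / 2 ^ k :: real)"
      by (intro sum.cong) auto
    then show "(\<Sum>j\<in>{2^k..<2^Suc k}. 1 / 2 ^ floor_log j) = (1 :: real)" by simp
  qed simp
  finally show ?thesis using assms by (simp add: dyadic_fun_def)
qed

lemma dyadic_fun_unit_vec:
  "i \<in> {1..<2^m} \<Longrightarrow> dyadic_fun m (unit_vec i) = 1 / m"
  by (simp add: dyadic_fun_def Rep_unit_vec)

text \<open>Used to find a positive coordinate of a functional from its value at the dyadic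
  vector.\<close>

lemma dyadic_vec_expansion:
  "dyadic_vec m = (\<Sum>j\<in>{1..<2^m}. Rep_schreier (dyadic_vec m) j *\<^sub>R unit_vec j)"
proof -
  have Rep_sum: "Rep_schreier (\<Sum>j\<in>A. f j) i = (\<Sum>j\<in>A. Rep_schreier (f j) i)"
    if "finite A" for A :: "nat set" and f i
    using that by induction (simp_all add: Rep_schreier_simps)
  have "Rep_schreier (\<Sum>j\<in>{1..<2^m}. Rep_schreier (dyadic_vec m) j *\<^sub>R unit_vec j) i
      = (\<Sum>j\<in>{1..<2^m}. if j = i then Rep_schreier (dyadic_vec m) i else 0)" for i
    by (subst Rep_sum) (simp, intro sum.cong, auto simp: Rep_schreier_simps Rep_unit_vec)
  then show ?thesis
    by (auto simp: Rep_schreier_inject[symmetric] fun_eq_iff Rep_dyadic_vec)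
qed

lemma blinfun_apply_dyadic_vec_le:
  fixes w :: "schreier \<Rightarrow>\<^sub>L real"
  assumes "norm w \<le> 1"
  shows "blinfun_apply w (dyadic_vec m) \<le> 1"
proof -
  have "blinfun_apply w (dyadic_vec m) \<le> norm w * norm (dyadic_vec m)"
    using norm_blinfun[of w "dyadic_vec m"] by simp
  also have "\<dots> \<le> 1 * 1" using assms norm_dyadic_vec by (intro mult_mono) auto
  finally show ?thesis by simp
qed

text \<open>Flipping the sign of a coordinate of the dyadic vector does not change its norm.\<close>

lemma norming_coord_nonneg:
  fixes z :: "schreier \<Rightarrow>\<^sub>L real"
  assumes nz: "norm z \<le> 1" and z1: "blinfun_apply z (dyadic_vec m) = 1" and i: "i \<in> {1..<2^m}"
  shows "blinfun_apply z (unit_vec i) \<ge> 0"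
proof -
  define c where "c = Rep_schreier (dyadic_vec m) i"
  have c: "c > 0" using i by (simp add: c_def Rep_dyadic_vec)
  define x where "x = dyadic_vec m - (2 * c) *\<^sub>R unit_vec i"
  have "\<bar>Rep_schreier x j\<bar> = \<bar>Rep_schreier (dyadic_vec m) j\<bar>" for j
    using i by (simp add: x_def Rep_schreier_simps Rep_unit_vec c_def)
  then have "norm x \<le> norm (dyadic_vec m)"
    by (intro norm_schreier_leI) (simp add: sum_le_norm_schreier)
  then have nx: "norm x \<le> 1" using norm_dyadic_vec[of m] by linarith
  have "blinfun_apply z x \<le> norm z * norm x" using norm_blinfun[of z x] by simp
  also have "\<dots> \<le> 1 * 1" using nz nx by (intro mult_mono) auto
  finally have "1 - 2 * c * blinfun_apply z (unit_vec i) \<le> 1"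
    using z1 by (simp add: x_def blinfun.bilinear_simps)
  then show ?thesis using c by (simp add: zero_le_mult_iff)
qed

section \<open>The bound on the weight of an extreme point\<close>

lemma lambda_triple_dyadic_fun_le:
  assumes m: "m > 0" and trip: "lambda_triple e z l (Blinfun (dyadic_fun m))"
  shows "l \<le> 1 / m"
proof -
  have ext: "e extreme_point_of cball 0 1" and nz: "norm z \<le> 1" and l: "0 < l" "l \<le> 1"
    and eq: "Blinfun (dyadic_fun m) = l *\<^sub>R e + (1 - l) *\<^sub>R z"
    using trip by (auto simp: lambda_triple_def)
  have ne: "norm e \<le> 1" using ext by (simp add: extreme_point_of_def)
  have eq_app: "dyadic_fun m x = l * blinfun_apply e x + (1 - l) * blinfun_apply z x" for x
    using arg_cong[OF eq, of "\<lambda>w. blinfun_apply w x"]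
    by (simp add: bounded_linear_Blinfun_apply bounded_linear_dyadic_fun blinfun.bilinear_simps)
  have le: "blinfun_apply e (dyadic_vec m) \<le> 1" "blinfun_apply z (dyadic_vec m) \<le> 1"
    using ne nz by (simp_all add: blinfun_apply_dyadic_vec_le)
  \<comment> \<open>Both defects from \<open>1\<close> are nonnegative, so both weighted terms
    vanish. For \<open>l = 1\<close> this says nothing about \<open>z\<close>.\<close>
  have sum0: "l * (1 - blinfun_apply e (dyadic_vec m)) + (1 - l) * (1 - blinfun_apply z (dyadic_vec m)) = 0"
    using eq_app[of "dyadic_vec m"] dyadic_fun_dyadic_vec[OF m] by (simp add: algebra_simps)
  have "l * (1 - blinfun_apply e (dyadic_vec m)) \<ge> 0" "(1 - l) * (1 - blinfun_apply z (dyadic_vec m)) \<ge> 0"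
    using le l by simp_all
  with sum0 have prods: "l * (1 - blinfun_apply e (dyadic_vec m)) = 0"
      "(1 - l) * (1 - blinfun_apply z (dyadic_vec m)) = 0"
    by linarith+
  have e1: "blinfun_apply e (dyadic_vec m) = 1" using prods(1) l by simp
  \<comment> \<open>A sum equal to \<open>1\<close> has a positive term, and the weights on this
    range are positive.\<close>
  have "(\<Sum>j\<in>{1..<2^m}. Rep_schreier (dyadic_vec m) j * blinfun_apply e (unit_vec j)) = 1"
    using e1 by (subst (asm) dyadic_vec_expansion) (simp add: blinfun.bilinear_simps blinfun.sum_right)
  then obtain i where i: "i \<in> {1..<2^m}"
    and "Rep_schreier (dyadic_vec m) i * blinfun_apply e (unit_vec i) > 0"
    by (metis (no_types, lifting) sum_nonpos not_le zero_less_one)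
  then have "blinfun_apply e (unit_vec i) > 0"
    by (simp add: Rep_dyadic_vec zero_less_divide_iff)
  then have ei: "blinfun_apply e (unit_vec i) \<ge> 1"
    using extreme_coord_ge_1[OF _ ext] i by simp
  \<comment> \<open>Either \<open>l = 1\<close> or \<open>z\<close> norms the dyadic vector.\<close>
  have zi: "(1 - l) * blinfun_apply z (unit_vec i) \<ge> 0"
    using prods(2) norming_coord_nonneg[OF nz _ i] l by auto
  \<comment> \<open>At \<open>i\<close> the convex combination equals \<open>1 / m\<close>, while
    its first term alone is at least \<open>l\<close>.\<close>
  have "l * 1 \<le> l * blinfun_apply e (unit_vec i)"
    using ei l by (intro mult_left_mono) auto
  then show ?thesis
    using zi eq_app[of "unit_vec i"] dyadic_fun_unit_vec[OF i] by linarith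
qed

theorem theorem1p2: "\<not> uniform_lambda_property TYPE(schreier \<Rightarrow>\<^sub>L real)"
proof
  assume "uniform_lambda_property TYPE(schreier \<Rightarrow>\<^sub>L real)"
  then obtain l0 where l0: "l0 > 0"
    "\<And>y :: schreier \<Rightarrow>\<^sub>L real. norm y \<le> 1 \<Longrightarrow> lambda_fun y \<ge> l0"
    by (auto simp: uniform_lambda_property_def)
  obtain n where n: "1 / real (Suc n) < l0"
    using nat_approx_posE[OF l0(1)] by auto
  define m where "m = Suc n"
  have "norm (Blinfun (dyadic_fun m)) \<le> 1"
    by (rule norm_blinfun_bound)
      (simp_all add: bounded_linear_Blinfun_apply bounded_linear_dyadic_fun dyadic_fun_le_norm)
  then have "l0 \<le> lambda_fun (Blinfun (dyadic_fun m))" by (rule l0(2))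
  \<comment> \<open>The inserted \<open>0\<close> keeps the set nonempty and obeys the same bound,
    so no decomposition has to be exhibited.\<close>
  also have "\<dots> \<le> 1 / m"
    unfolding lambda_fun_def
    by (rule cSup_least) (auto simp: m_def simp del: of_nat_Suc intro: lambda_triple_dyadic_fun_le)
  finally show False using n by (simp add: m_def)
qed

end
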